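(* Let $(\Sigma,m)$ be a weighted simplicial complex with coboundary operator $\delta$ and boundary operator $\partial$. If either $\omega\in F^c$ and $\eta\in F$, or $\omega\in F^1$ and $\eta\in F^c$, then $$\sum_{\Sigma}m(\partial\omega)\eta=\sum_{\Sigma}m\,\omega(\delta\eta).$$
   Context: Simplicial complex: $V$ is a countable set and $\hat\Sigma$ is a collection of finite subsets of $V$ closed under taking subsets. $\dim\tau=|\tau|-1$, $\hat\Sigma_k=\{\tau\in\hat\Sigma:\dim\tau=k\}$. A weight is a function $m:\hat\Sigma\to(0,\infty)$. Put $\Sigma=\hat\Sigma$ if $\sum_{v\in\hat\Sigma_0}m(v)<\infty$, and $\Sigma=\hat\Sigma\setminus\{\varnothing\}$ otherwise; $\Sigma_k=\hat\Sigma_k\cap\Sigma$. For $\tau,\sigma\in\Sigma$, $\tau\prec\sigma$ (equivalently $\sigma\succ\tau$) means $\tau\subset\sigma$ and $|\sigma\setminus\tau|=1$. All sums are over elements of $\Sigma$. Functions: $F=\mathbb{R}^{\Sigma}$; $F^c\subseteq F$ is the subspace of finitely supported functions; $F^1=\{\omega\in F:\sum_{\sigma\succ\tau}m(\sigma)|\omega(\sigma)|<\infty\text{ for all }\tau\in\Sigma\}$. $1_\tau$ is the characteristic function of $\{\tau\}$. $\sum_\Sigma f=\sum_{\sigma\in\Sigma}f(\sigma)$ whenever this converges absolutely (absolute convergence is part of the claim). Coboundary operator: a linear map $\delta:F\to F$ with $\delta\delta=0$ such that $\theta(\tau,\sigma):=\delta 1_\tau(\sigma)\in\{-1,0,1\}$,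 $\theta(\tau,\sigma)\neq0$ iff $\tau\prec\sigma$, and $\delta\omega(\sigma)=\sum_{\tau\prec\sigma}\omega(\tau)\theta(\tau,\sigma)$. Boundary operator: $\partial:F^1\to F$, $\partial\omega(\rho)=\frac1{m(\rho)}\sum_{\tau\succ\rho}m(\tau)\omega(\tau)\theta(\rho,\tau)$. *)

theory Defs
  imports "HOL-Analysis.Infinite_Sum"
begin

definition simplicial_complex :: "'v set \<Rightarrow> 'v set set \<Rightarrow> bool" where
  "simplicial_complex V K \<longleftrightarrow>
     countable V \<and> (\<forall>\<tau>\<in>K. finite \<tau> \<and> \<tau> \<subseteq> V) \<and> (\<forall>\<tau>\<in>K. \<forall>\<rho>. \<rho> \<subseteq> \<tau> \<longrightarrow> \<rho> \<in> K)"

text \<open>A weight is a positive function on \<open>K\<close>; its values outside \<open>K\<close> are never used.\<close>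

definition weighted_complex :: "'v set \<Rightarrow> 'v set set \<Rightarrow> ('v set \<Rightarrow> real) \<Rightarrow> bool" where
  "weighted_complex V K m \<longleftrightarrow> simplicial_complex V K \<and> (\<forall>\<tau>\<in>K. 0 < m \<tau>)"

definition sdim :: "'v set \<Rightarrow> int" where
  "sdim \<tau> = int (card \<tau>) - 1"

definition skeleton :: "'v set set \<Rightarrow> int \<Rightarrow> 'v set set" where
  "skeleton K k = {\<tau>\<in>K. sdim \<tau> = k}"

text \<open>The empty simplex is kept exactly when the total vertex weight is finite;
  \<open>K\<close> plays the role of the hatted complex and \<open>simplices K m\<close> that of the unhatted one.\<close>

definition simplices :: "'v set set \<Rightarrow> ('v set \<Rightarrow> real) \<Rightarrow> 'v set set" where
  "simplices K m = (if m summable_on skeleton K 0 then K else K - {{}})"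

definition face :: "'v set set \<Rightarrow> 'v set \<Rightarrow> 'v set \<Rightarrow> bool" where
  "face S \<tau> \<sigma> \<longleftrightarrow> \<tau> \<in> S \<and> \<sigma> \<in> S \<and> \<tau> \<subset> \<sigma> \<and> card (\<sigma> - \<tau>) = 1"

text \<open>Real functions on \<open>S\<close> are represented by their extensions by zero.\<close>

definition forms :: "'v set set \<Rightarrow> ('v set \<Rightarrow> real) set" where
  "forms S = {\<omega>. \<forall>\<tau>. \<tau> \<notin> S \<longrightarrow> \<omega> \<tau> = 0}"

definition forms_c :: "'v set set \<Rightarrow> ('v set \<Rightarrow> real) set" where
  "forms_c S = {\<omega> \<in> forms S. finite {\<tau>\<in>S. \<omega> \<tau> \<noteq> 0}}"

definition forms_1 :: "'v set set \<Rightarrow> ('v set \<Rightarrow> real) \<Rightarrow> ('v set \<Rightarrow> real) set" where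
  "forms_1 S m =
     {\<omega> \<in> forms S. \<forall>\<tau>\<in>S. (\<lambda>\<sigma>. m \<sigma> * \<bar>\<omega> \<sigma>\<bar>) summable_on {\<sigma>. face S \<tau> \<sigma>}}"

definition incidence ::
  "(('v set \<Rightarrow> real) \<Rightarrow> 'v set \<Rightarrow> real) \<Rightarrow> 'v set \<Rightarrow> 'v set \<Rightarrow> real" where
  "incidence \<delta> \<tau> \<sigma> = \<delta> (indicator {\<tau>}) \<sigma>"

definition linear_on_forms ::
  "'v set set \<Rightarrow> (('v set \<Rightarrow> real) \<Rightarrow> 'v set \<Rightarrow> real) \<Rightarrow> bool" where
  "linear_on_forms S \<delta> \<longleftrightarrow>
     (\<forall>\<omega>\<in>forms S. \<forall>\<eta>\<in>forms S. \<delta> (\<lambda>\<tau>. \<omega> \<tau> + \<eta> \<tau>) = (\<lambda>\<sigma>. \<delta> \<omega> \<sigma> + \<delta> \<eta> \<sigma>)) \<and>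
     (\<forall>c. \<forall>\<omega>\<in>forms S. \<delta> (\<lambda>\<tau>. c * \<omega> \<tau>) = (\<lambda>\<sigma>. c * \<delta> \<omega> \<sigma>))"

text \<open>The sum below is finite, since a finite simplex has only finitely many faces
  (see \<open>finite_faces\<close>).\<close>

definition coboundary_operator ::
  "'v set set \<Rightarrow> (('v set \<Rightarrow> real) \<Rightarrow> 'v set \<Rightarrow> real) \<Rightarrow> bool" where
  "coboundary_operator S \<delta> \<longleftrightarrow>
     (\<forall>\<omega>\<in>forms S. \<delta> \<omega> \<in> forms S) \<and>
     linear_on_forms S \<delta> \<and>
     (\<forall>\<omega>\<in>forms S. \<delta> (\<delta> \<omega>) = (\<lambda>_. 0)) \<and>
     (\<forall>\<tau>\<in>S. \<forall>\<sigma>\<in>S. incidence \<delta> \<tau> \<sigma> \<in> {-1, 0, 1} \<and>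
                     (incidence \<delta> \<tau> \<sigma> \<noteq> 0 \<longleftrightarrow> face S \<tau> \<sigma>)) \<and>
     (\<forall>\<omega>\<in>forms S. \<forall>\<sigma>\<in>S. \<delta> \<omega> \<sigma> = (\<Sum>\<tau> | face S \<tau> \<sigma>. \<omega> \<tau> * incidence \<delta> \<tau> \<sigma>))"

definition boundary ::
  "'v set set \<Rightarrow> ('v set \<Rightarrow> real) \<Rightarrow> (('v set \<Rightarrow> real) \<Rightarrow> 'v set \<Rightarrow> real)
    \<Rightarrow> ('v set \<Rightarrow> real) \<Rightarrow> 'v set \<Rightarrow> real" where
  "boundary S m \<delta> \<omega> \<rho> =
     (if \<rho> \<in> S
      then 1 / m \<rho> * (\<Sum>\<^sub>\<infinity>\<tau> | face S \<rho> \<tau>. m \<tau> * \<omega> \<tau> * incidence \<delta> \<rho> \<tau>)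
      else 0)"

lemma finite_faces:
  assumes "weighted_complex V K m"
  shows "finite {\<tau>. face (simplices K m) \<tau> \<sigma>}"
proof (cases "\<sigma> \<in> simplices K m")
  case True
  then have "finite \<sigma>"
    using assms
    by (auto simp: weighted_complex_def simplicial_complex_def simplices_def split: if_splits)
  then have "finite (Pow \<sigma>)" by simp
  then show ?thesis
    by (rule rev_finite_subset) (auto simp: face_def)
qed (simp add: face_def)

lemma forms_c_subset_forms_1: "forms_c S \<subseteq> forms_1 S m"
proof
  fix \<omega> assume w: "\<omega> \<in> forms_c S"
  have "(\<lambda>\<sigma>. m \<sigma> * \<bar>\<omega> \<sigma>\<bar>) summable_on {\<sigma>. face S \<tau> \<sigma>}" for \<tau>
  proof -
    have "finite {\<sigma>. face S \<tau> \<sigma> \<and> \<omega> \<sigma> \<noteq> 0}"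
      using w by (auto simp: forms_c_def face_def elim: rev_finite_subset)
    then have "(\<lambda>\<sigma>. m \<sigma> * \<bar>\<omega> \<sigma>\<bar>) summable_on {\<sigma>. face S \<tau> \<sigma> \<and> \<omega> \<sigma> \<noteq> 0}"
      by (rule summable_on_finite)
    then show ?thesis
      by (rule summable_on_cong_neutral[THEN iffD1, rotated -1]) auto
  qed
  then show "\<omega> \<in> forms_1 S m"
    using w by (simp add: forms_1_def forms_c_def)
qed

end

theory Submission
  imports Defs
begin

text \<open>Both sides are iterated sums of one family, \<open>m \<tau> * \<omega> \<tau> * \<eta>
  \<rho> * incidence \<delta> \<rho> \<tau>\<close>, indexed by the pairs with
  \<open>face S \<rho> \<tau>\<close>. Summing over the cofaces \<tau> first gives the left side,
  because the weight of \<rho> cancels the normalisation in \<open>boundary\<close>; summing over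
  the faces \<rho> first gives the right side, by the formula for \<delta>. The theorem is therefore
  Fubini, and its analytic content is the absolute summability of the family over all pairs,
  \<open>boundary_coboundary_summable\<close>. That holds because one of the two functions has
  finite support, which leaves finitely many fibres, each absolutely summable.\<close>

text \<open>Outside the finite set \<open>A\<close> the fibres contribute nothing, and over
  \<open>A\<close> the outer sum is finite, so only summability along each fibre remains.\<close>

lemma abs_summable_on_Sigma_finite_support:
  fixes f :: "'a \<times> 'b \<Rightarrow> real"
  assumes "finite A" "A \<subseteq> S"
    and "\<And>x. x \<in> A \<Longrightarrow> (\<lambda>y. f (x, y)) abs_summable_on B x"
    and "\<And>x y. x \<in> S - A \<Longrightarrow> y \<in> B x \<Longrightarrow> f (x, y) = 0"
  shows "f abs_summable_on Sigma S B"
proof -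
  have "f abs_summable_on Sigma A B"
    unfolding abs_summable_on_Sigma_iff using assms by (auto intro: summable_on_finite)
  then show ?thesis
    by (rule summable_on_cong_neutral[THEN iffD1, rotated -1]) (use assms in auto)
qed

lemma boundary_coboundary_summable:
  assumes fin: "\<And>\<sigma>. finite {\<tau>. face S \<tau> \<sigma>}"
    and \<delta>: "coboundary_operator S \<delta>"
    and "(\<omega> \<in> forms_c S \<and> \<eta> \<in> forms S) \<or> (\<omega> \<in> forms_1 S m \<and> \<eta> \<in> forms_c S)"
    and m: "\<And>\<sigma>. \<sigma> \<in> S \<Longrightarrow> 0 < m \<sigma>"
  shows "(\<lambda>(\<rho>, \<tau>). m \<tau> * \<omega> \<tau> * \<eta> \<rho> * incidence \<delta> \<rho> \<tau>)
           abs_summable_on (SIGMA \<rho>:S. {\<tau>. face S \<rho> \<tau>})"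
    (is "?f abs_summable_on _")
  using assms(3)
proof
  assume *: "\<omega> \<in> forms_c S \<and> \<eta> \<in> forms S"
  \<comment> \<open>The finite support is in the coface \<tau>, so the pairs are fibred over \<tau>;
    each fibre is finite since a simplex has finitely many faces. Swapping coordinates returns to
    the required index set.\<close>
  have "(\<lambda>(\<tau>, \<rho>). ?f (\<rho>, \<tau>)) abs_summable_on (SIGMA \<tau>:S. {\<rho>. face S \<rho> \<tau>})"
    by (rule abs_summable_on_Sigma_finite_support[where A = "{\<tau>\<in>S. \<omega> \<tau> \<noteq> 0}"])
      (use * in \<open>auto simp: forms_c_def intro: summable_on_finite fin\<close>)
  then have "(\<lambda>p. norm (?f (prod.swap p))) summable_on (SIGMA \<tau>:S. {\<rho>. face S \<rho> \<tau>})"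
    by (simp add: case_prod_unfold)
  then have "(\<lambda>p. norm (?f p)) summable_on prod.swap ` (SIGMA \<tau>:S. {\<rho>. face S \<rho> \<tau>})"
    by (subst summable_on_reindex) (auto simp: o_def)
  moreover have "prod.swap ` (SIGMA \<tau>:S. {\<rho>. face S \<rho> \<tau>}) = (SIGMA \<rho>:S. {\<tau>. face S \<rho> \<tau>})"
    by (force simp: face_def)
  ultimately show ?thesis by simp
next
  assume *: "\<omega> \<in> forms_1 S m \<and> \<eta> \<in> forms_c S"
  have "(\<lambda>\<tau>. ?f (\<rho>, \<tau>)) abs_summable_on {\<tau>. face S \<rho> \<tau>}" if \<rho>: "\<rho> \<in> S" for \<rho>
  proof (rule summable_on_comparison_test)
    \<comment> \<open>As incidence numbers have absolute value at most 1, this majorant suffices;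
      its summability is the defining condition of \<open>forms_1\<close> at \<rho>.\<close>
    show "(\<lambda>\<tau>. \<bar>\<eta> \<rho>\<bar> * (m \<tau> * \<bar>\<omega> \<tau>\<bar>)) summable_on {\<tau>. face S \<rho> \<tau>}"
      using * \<rho> by (intro summable_on_cmult_right) (auto simp: forms_1_def)
    fix \<tau> assume \<tau>: "\<tau> \<in> {\<tau>. face S \<rho> \<tau>}"
    then have "\<tau> \<in> S" by (simp add: face_def)
    then have "0 < m \<tau>" "incidence \<delta> \<rho> \<tau> \<in> {-1, 0, 1}"
      using m \<delta> \<rho> by (auto simp: coboundary_operator_def)
    then have "0 < m \<tau>" "\<bar>incidence \<delta> \<rho> \<tau>\<bar> \<le> 1"
      by auto
    then show "norm (?f (\<rho>, \<tau>)) \<le> \<bar>\<eta> \<rho>\<bar> * (m \<tau> * \<bar>\<omega> \<tau>\<bar>)"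
      by (auto simp: abs_mult mult_ac intro!: mult_left_mono mult_left_le)
  qed simp
  then show ?thesis
    by (intro abs_summable_on_Sigma_finite_support[where A = "{\<rho>\<in>S. \<eta> \<rho> \<noteq> 0}"])
      (use * in \<open>auto simp: forms_c_def\<close>)
qed

theorem theorem2p9:
  fixes V :: "'v set" and K S :: "'v set set" and m :: "'v set \<Rightarrow> real"
    and \<delta> :: "('v set \<Rightarrow> real) \<Rightarrow> 'v set \<Rightarrow> real"
    and \<omega> \<eta> :: "'v set \<Rightarrow> real"
  assumes "weighted_complex V K m"
    and "S = simplices K m"
    and "coboundary_operator S \<delta>"
    and "(\<omega> \<in> forms_c S \<and> \<eta> \<in> forms S) \<or> (\<omega> \<in> forms_1 S m \<and> \<eta> \<in> forms_c S)"
  shows "(\<lambda>\<sigma>. m \<sigma> * boundary S m \<delta> \<omega> \<sigma> * \<eta> \<sigma>) abs_summable_on S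
       \<and> (\<lambda>\<sigma>. m \<sigma> * \<omega> \<sigma> * \<delta> \<eta> \<sigma>) abs_summable_on S
       \<and> (\<Sum>\<^sub>\<infinity>\<sigma>\<in>S. m \<sigma> * boundary S m \<delta> \<omega> \<sigma> * \<eta> \<sigma>) = (\<Sum>\<^sub>\<infinity>\<sigma>\<in>S. m \<sigma> * \<omega> \<sigma> * \<delta> \<eta> \<sigma>)"
proof -
  define f where "f = (\<lambda>\<rho> \<tau>. m \<tau> * \<omega> \<tau> * \<eta> \<rho> * incidence \<delta> \<rho> \<tau>)"
  let ?P = "SIGMA \<rho>:S. {\<tau>. face S \<rho> \<tau>}" and ?Q = "SIGMA \<tau>:S. {\<rho>. face S \<rho> \<tau>}"
  have fin: "finite {\<tau>. face S \<tau> \<sigma>}" for \<sigma>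
    using finite_faces[OF assms(1)] assms(2) by simp
  have m: "0 < m \<sigma>" if "\<sigma> \<in> S" for \<sigma>
    using that assms(1,2) by (auto simp: weighted_complex_def simplices_def split: if_splits)
  have \<eta>: "\<eta> \<in> forms S"
    using assms(4) by (auto simp: forms_c_def)
  \<comment> \<open>\<open>face S\<close> places both simplices in \<open>S\<close>, so fibring over
    faces or over cofaces yields the same pairs.\<close>
  have swap: "?P = prod.swap ` ?Q"
    by (force simp: face_def)
  have P: "(\<lambda>(\<rho>, \<tau>). f \<rho> \<tau>) summable_on ?P"
    using boundary_coboundary_summable[OF fin assms(3,4) m]
    unfolding f_def by (rule summable_on_iff_abs_summable_on_real[THEN iffD2])
  have Q: "(\<lambda>(\<tau>, \<rho>). f \<rho> \<tau>) summable_on ?Q"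
    using P unfolding swap by (subst (asm) summable_on_reindex) (auto simp: o_def case_prod_unfold)
  have bd: "(\<Sum>\<^sub>\<infinity>\<tau> | face S \<rho> \<tau>. f \<rho> \<tau>) = m \<rho> * boundary S m \<delta> \<omega> \<rho> * \<eta> \<rho>" if "\<rho> \<in> S" for \<rho>
  proof -
    have "(\<Sum>\<^sub>\<infinity>\<tau> | face S \<rho> \<tau>. f \<rho> \<tau>)
        = (\<Sum>\<^sub>\<infinity>\<tau> | face S \<rho> \<tau>. m \<tau> * \<omega> \<tau> * incidence \<delta> \<rho> \<tau> * \<eta> \<rho>)"
      by (simp add: f_def mult_ac)
    \<comment> \<open>The constant \<open>\<eta> \<rho>\<close> leaves the sum without a summability
      condition, since the reals are a field; positivity of \<open>m \<rho>\<close> allows the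
      cancellation.\<close>
    then show ?thesis
      using m[OF that] that by (simp add: boundary_def infsum_cmult_left')
  qed
  have cobd: "(\<Sum>\<^sub>\<infinity>\<rho> | face S \<rho> \<tau>. f \<rho> \<tau>) = m \<tau> * \<omega> \<tau> * \<delta> \<eta> \<tau>" if "\<tau> \<in> S" for \<tau>
    \<comment> \<open>Finiteness of the set of faces turns the infinite sum into the finite one that
      defines \<open>\<delta> \<eta>\<close>.\<close>
    using assms(3) \<eta> that fin
    by (simp add: coboundary_operator_def f_def sum_distrib_left mult_ac)
  \<comment> \<open>The fibre sums of a summable family are themselves summable; for real values
    this is the same as absolute summability, as the claim requires.\<close>
  have "(\<lambda>\<rho>. m \<rho> * boundary S m \<delta> \<omega> \<rho> * \<eta> \<rho>) summable_on S"
    using summable_on_Sigma_banach[OF P] by (simp add: bd cong: summable_on_cong)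
  moreover have "(\<lambda>\<tau>. m \<tau> * \<omega> \<tau> * \<delta> \<eta> \<tau>) summable_on S"
    using summable_on_Sigma_banach[OF Q] by (simp add: cobd cong: summable_on_cong)
  moreover have "(\<Sum>\<^sub>\<infinity>\<rho>\<in>S. m \<rho> * boundary S m \<delta> \<omega> \<rho> * \<eta> \<rho>) = (\<Sum>\<^sub>\<infinity>\<tau>\<in>S. m \<tau> * \<omega> \<tau> * \<delta> \<eta> \<tau>)"
  proof -
    have "(\<Sum>\<^sub>\<infinity>\<rho>\<in>S. m \<rho> * boundary S m \<delta> \<omega> \<rho> * \<eta> \<rho>) = (\<Sum>\<^sub>\<infinity>\<rho>\<in>S. \<Sum>\<^sub>\<infinity>\<tau> | face S \<rho> \<tau>. f \<rho> \<tau>)"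
      by (simp add: bd cong: infsum_cong)
    also have "\<dots> = (\<Sum>\<^sub>\<infinity>(\<rho>, \<tau>)\<in>?P. f \<rho> \<tau>)"
      by (rule infsum_Sigma'_banach[OF P])
    also have "\<dots> = (\<Sum>\<^sub>\<infinity>(\<tau>, \<rho>)\<in>?Q. f \<rho> \<tau>)"
      unfolding swap by (subst infsum_reindex) (auto simp: o_def case_prod_unfold)
    also have "\<dots> = (\<Sum>\<^sub>\<infinity>\<tau>\<in>S. \<Sum>\<^sub>\<infinity>\<rho> | face S \<rho> \<tau>. f \<rho> \<tau>)"
      by (rule infsum_Sigma'_banach[OF Q, symmetric])
    also have "\<dots> = (\<Sum>\<^sub>\<infinity>\<tau>\<in>S. m \<tau> * \<omega> \<tau> * \<delta> \<eta> \<tau>)"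
      by (simp add: cobd cong: infsum_cong)
    finally show ?thesis .
  qed
  ultimately show ?thesis
    by (intro conjI summable_on_iff_abs_summable_on_real[THEN iffD1])
qed

end
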